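(* Let $A$ be a finite alphabet and $F:A^{\mathbb{Z}^2}\to A^{\mathbb{Z}^2}$ a cellular automaton. Then $$ER(A^{\mathbb{Z}^2},F)\ge\sup_{\mu\in M(F,\sigma)}ER_\mu(A^{\mathbb{Z}^2},F)\quad\text{and}\quad ER(A^{\mathbb{Z}^2},F)\ge\sup_{\mu\in M(F)}ER_\mu(\mathcal{S}_0,F),$$ where $M(F)$ is the set of $F$-invariant probability measures on $A^{\mathbb{Z}^2}$ and $M(F,\sigma)$ is the set of probability measures invariant under both $F$ and all shifts.
   Context: $A^{\mathbb{Z}^2}$ carries the product of discrete topologies and its Borel $\sigma$-algebra. The shifts are $\sigma^v(x)_u=x_{u+v}$, $u,v\in\mathbb{Z}^2$. Let $E_n=\{(i,j)\in\mathbb{Z}^2: -n\le i,j\le n\}$. A cellular automaton (CA) $F$ is a continuous self-map of $A^{\mathbb{Z}^2}$ commuting with all shifts; equivalently there are $r\in\mathbb{N}$ and $f:A^{E_r}\to A$ with $F(x)_z=f\big((x_{z+u})_{u\in E_r}\big)$ for all $z$; such an $r$ is called the radius of $F$. For $n\ge r$, $E'_n=E_n\setminus E_{n-r}$. For a finite measurable partition or finite open cover $\mathcal{P}$, $\mathcal{P}'_n=\bigvee_{v\in E'_n}\sigma^v(\mathcal{P})$. $\mathcal{S}_0$ is the clopen partition according to the coordinate at $(0,0)$. Measure-theoretic: $h_\mu(\mathcal{P},F)=\lim_{N}\frac1N H_\mu(\bigvee_{i=0}^{N-1}F^{-i}\mathcal{P})$ with $H_\mu$ the Shannon entropy of a partition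 (natural logarithm); $ER_\mu(\mathcal{P},F)=\limsup_{n\to\infty}\frac1n h_\mu(\mathcal{P}'_n,F)$; $ER_\mu(A^{\mathbb{Z}^2},F)=\sup_{\mathcal{P}}ER_\mu(\mathcal{P},F)$ over all finite measurable partitions. Topological: for an open cover $\mathcal{U}$, $H(\mathcal{U})=\ln N(\mathcal{U})$ with $N(\mathcal{U})$ the smallest cardinality of a subcover; $h(\mathcal{U},F)=\lim_{N}\frac1N H(\bigvee_{i=0}^{N-1}F^{-i}\mathcal{U})$; $ER(\mathcal{C},F)=\limsup_{n\to\infty}\frac1n h(\mathcal{C}'_n,F)$; $ER(A^{\mathbb{Z}^2},F)=\sup_{\mathcal{C}}ER(\mathcal{C},F)$ over all finite open covers. *)

theory Defs
  imports "HOL-Probability.Probability"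
begin

text \<open>
  The alphabet is a type of sort \<open>{finite, discrete_topology}\<close>. The library's topology on
  function types is the product topology, so \<open>open\<close>, \<open>continuous_on\<close> and \<open>borel\<close> on the
  following type refer to the product of the discrete topologies.
\<close>

type_synonym 'a config = "int \<times> int \<Rightarrow> 'a"

definition shift :: "int \<times> int \<Rightarrow> 'a config \<Rightarrow> 'a config" where
  "shift v x = (\<lambda>u. x (u + v))"

definition square :: "nat \<Rightarrow> (int \<times> int) set" where
  "square n = {- int n..int n} \<times> {- int n..int n}"

text \<open>Truncated subtraction is harmless here: only \<open>n \<ge> r\<close> matters, since the frames are
  used only below a \<open>limsup\<close> in \<open>n\<close>.\<close>

definition frame :: "nat \<Rightarrow> nat \<Rightarrow> (int \<times> int) set" where
  "frame r n = square n - square (n - r)"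

definition cellular_automaton :: "('a::topological_space config \<Rightarrow> 'a config) \<Rightarrow> bool" where
  "cellular_automaton F \<longleftrightarrow> continuous_on UNIV F \<and> (\<forall>v. F \<circ> shift v = shift v \<circ> F)"

definition is_radius :: "nat \<Rightarrow> ('a config \<Rightarrow> 'a config) \<Rightarrow> bool" where
  "is_radius r F \<longleftrightarrow>
     (\<exists>f. \<forall>x z. F x z = f (restrict (\<lambda>u. x (z + u)) (square r)))"

text \<open>The join may contain the empty set even if all \<open>P i\<close> are partitions. This does not affect
  any of the entropies below.\<close>

definition join :: "'i set \<Rightarrow> ('i \<Rightarrow> 'x set set) \<Rightarrow> 'x set set" where
  "join I P = (\<lambda>f. \<Inter>i\<in>I. f i) ` (\<Pi>\<^sub>E i\<in>I. P i)"

definition dyn_join :: "('x \<Rightarrow> 'x) \<Rightarrow> 'x set set \<Rightarrow> nat \<Rightarrow> 'x set set" where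
  "dyn_join T P N = join {..<N} (\<lambda>i. (\<lambda>B. (T ^^ i) -` B) ` P)"

definition frame_join :: "nat \<Rightarrow> 'a config set set \<Rightarrow> nat \<Rightarrow> 'a config set set" where
  "frame_join r P n = join (frame r n) (\<lambda>v. (\<lambda>B. shift v ` B) ` P)"

definition finite_measurable_partition :: "'x::topological_space set set \<Rightarrow> bool" where
  "finite_measurable_partition P \<longleftrightarrow> finite P \<and> partition_on UNIV P \<and> P \<subseteq> sets borel"

definition finite_open_cover :: "'x::topological_space set set \<Rightarrow> bool" where
  "finite_open_cover C \<longleftrightarrow> finite C \<and> (\<forall>U\<in>C. open U) \<and> \<Union>C = UNIV"

definition zero_partition :: "'a config set set" where
  "zero_partition = range (\<lambda>a. {x. x (0, 0) = a})"

definition shannon_entropy :: "'x measure \<Rightarrow> 'x set set \<Rightarrow> real" where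
  "shannon_entropy \<mu> P = - (\<Sum>B\<in>P. measure \<mu> B * ln (measure \<mu> B))"

definition dyn_entropy :: "'x measure \<Rightarrow> 'x set set \<Rightarrow> ('x \<Rightarrow> 'x) \<Rightarrow> real" where
  "dyn_entropy \<mu> P T = lim (\<lambda>N. shannon_entropy \<mu> (dyn_join T P N) / real N)"

definition ER_partition ::
    "nat \<Rightarrow> 'a config measure \<Rightarrow> 'a config set set \<Rightarrow> ('a config \<Rightarrow> 'a config) \<Rightarrow> ereal" where
  "ER_partition r \<mu> P F = limsup (\<lambda>n. ereal (dyn_entropy \<mu> (frame_join r P n) F / real n))"

definition ER_measure ::
    "nat \<Rightarrow> 'a::topological_space config measure \<Rightarrow> ('a config \<Rightarrow> 'a config) \<Rightarrow> ereal" where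
  "ER_measure r \<mu> F = (SUP P \<in> {P. finite_measurable_partition P}. ER_partition r \<mu> P F)"

definition cover_number :: "'x set set \<Rightarrow> nat" where
  "cover_number C = (LEAST k. \<exists>V\<subseteq>C. finite V \<and> \<Union>V = UNIV \<and> card V = k)"

definition cover_entropy :: "'x set set \<Rightarrow> real" where
  "cover_entropy C = ln (real (cover_number C))"

definition dyn_cover_entropy :: "'x set set \<Rightarrow> ('x \<Rightarrow> 'x) \<Rightarrow> real" where
  "dyn_cover_entropy C T = lim (\<lambda>N. cover_entropy (dyn_join T C N) / real N)"

definition ER_cover ::
    "nat \<Rightarrow> 'a config set set \<Rightarrow> ('a config \<Rightarrow> 'a config) \<Rightarrow> ereal" where
  "ER_cover r C F = limsup (\<lambda>n. ereal (dyn_cover_entropy (frame_join r C n) F / real n))"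

definition ER_top :: "nat \<Rightarrow> ('a::topological_space config \<Rightarrow> 'a config) \<Rightarrow> ereal" where
  "ER_top r F = (SUP C \<in> {C. finite_open_cover C}. ER_cover r C F)"

definition invariant_measures ::
    "('a::topological_space config \<Rightarrow> 'a config) \<Rightarrow> 'a config measure set" where
  "invariant_measures F =
     {\<mu>. prob_space \<mu> \<and> sets \<mu> = sets borel \<and> distr \<mu> borel F = \<mu>}"

definition shift_invariant_measures ::
    "('a::topological_space config \<Rightarrow> 'a config) \<Rightarrow> 'a config measure set" where
  "shift_invariant_measures F =
     {\<mu> \<in> invariant_measures F. \<forall>v. distr \<mu> borel (shift v) = \<mu>}"

end

theory Submission
  imports Defs "HOL-Real_Asymp.Real_Asymp"
begin

text \<open>
  For a partition \<open>Q\<close> into clopen sets, the minimal subcover of a dynamical join of \<open>Q\<close> consists of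
  its nonempty cells, so its Shannon entropy is at most its cover entropy. As the partition by the
  coordinate at the origin is clopen, this gives the second inequality. For the first one, let \<open>\<mu>\<close>
  be invariant under the automaton and all shifts, and let \<open>P\<close> be a finite measurable partition.
  Choose a clopen partition \<open>Q\<close> with \<open>H (P | Q) < e\<close>. Subadditivity of conditional entropy and
  invariance of \<open>\<mu>\<close> bound the entropies of the frame joins of \<open>P\<close> by those of \<open>Q\<close> plus \<open>e\<close> times the
  cardinality of the frame, and this cardinality is at most \<open>12 r n\<close>, so the error after division
  by \<open>n\<close> is \<open>12 r e\<close>.
\<close>

subsection \<open>Partitions as labellings\<close>

text \<open>A partition is handled through a labelling whose level sets are its cells. \<open>P\<close> may contain
  \<open>{}\<close> in addition, as the joins do.\<close>

definition labels :: "('x \<Rightarrow> 'k) \<Rightarrow> 'x set set \<Rightarrow> bool" where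
  "labels X P \<longleftrightarrow> (\<forall>B\<in>P. \<forall>x\<in>B. B = X -` {X x}) \<and> (\<forall>x. X -` {X x} \<in> P)"

lemma labels_imp_diff_empty:
  assumes "labels X P"
  shows "P - {{}} = (\<lambda>k. X -` {k}) ` range X"
  using assms unfolding labels_def by (auto 0 3)

lemma labels_level_sets: "labels X ((\<lambda>k. X -` {k}) ` range X)"
  by (auto simp: labels_def)

lemma restrict_eq_iff: "restrict f I = restrict g I \<longleftrightarrow> (\<forall>i\<in>I. f i = g i)"
  by (metis restrict_apply' restrict_ext)

text \<open>Two points lie in the same cell of every \<open>P i\<close> exactly when their tuples of
  labels agree. An empty intersection satisfies the first clause of \<open>labels\<close>
  vacuously.\<close>

lemma labels_join:
  assumes "\<And>i. i \<in> I \<Longrightarrow> labels (X i) (P i)"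
  shows "labels (\<lambda>x. restrict (\<lambda>i. X i x) I) (join I P)"
proof -
  have level: "(\<lambda>x. restrict (\<lambda>i. X i x) I) -` {restrict (\<lambda>i. X i x) I} = (\<Inter>i\<in>I. X i -` {X i x})"
    for x by (auto simp: restrict_eq_iff)
  show ?thesis
    unfolding labels_def level
  proof (intro conjI ballI allI)
    fix B x
    assume "B \<in> join I P" and x: "x \<in> B"
    then obtain f where f: "f \<in> (\<Pi>\<^sub>E i\<in>I. P i)" and B: "B = (\<Inter>i\<in>I. f i)"
      by (auto simp: join_def)
    have "f i = X i -` {X i x}" if "i \<in> I" for i
      using assms[OF that] f x that unfolding B labels_def by (auto simp: PiE_iff)
    then show "B = (\<Inter>i\<in>I. X i -` {X i x})"
      unfolding B by auto
  next
    fix x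
    show "(\<Inter>i\<in>I. X i -` {X i x}) \<in> join I P"
      unfolding join_def
      by (rule image_eqI[of _ _ "restrict (\<lambda>i. X i -` {X i x}) I"])
         (use assms in \<open>auto simp: labels_def\<close>)
  qed
qed

lemma labels_vimage:
  assumes "labels X P"
  shows "labels (\<lambda>x. X (T x)) ((\<lambda>B. T -` B) ` P)"
proof -
  have *: "(\<lambda>x. X (T x)) -` {X (T x)} = T -` (X -` {X (T x)})" for x
    by auto
  show ?thesis
    using assms unfolding labels_def * by (auto 0 3)
qed

text \<open>Each point is labelled by the very cell that contains it.\<close>

lemma labels_partition_on:
  assumes "partition_on UNIV P"
  shows "labels (\<lambda>x. THE B. B \<in> P \<and> x \<in> B) P"
proof -
  let ?X = "\<lambda>x. THE B. B \<in> P \<and> x \<in> B"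
  have X: "?X x = B" if "B \<in> P" "x \<in> B" for B x
    using assms that by (intro the_equality) (auto simp: partition_on_def disjoint_def)
  have ex: "\<exists>B\<in>P. x \<in> B" for x
    using assms by (auto simp: partition_on_def)
  have level: "?X -` {B} = B" if B: "B \<in> P" for B
  proof (intro equalityI subsetI)
    fix x assume "x \<in> ?X -` {B}"
    then show "x \<in> B"
      using ex[of x] X by auto
  qed (use X B in auto)
  show ?thesis
    unfolding labels_def
  proof (intro conjI ballI allI)
    fix B x assume "B \<in> P" "x \<in> B"
    then show "B = ?X -` {?X x}"
      using level X by simp
  next
    fix x
    obtain B where "B \<in> P" "x \<in> B"
      using ex by blast
    then show "?X -` {?X x} \<in> P"
      using level X by simp
  qed
qed

text \<open>The cells are disjoint, so a subcover cannot omit a nonempty one, and the nonempty cells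
  alone already cover.\<close>

lemma cover_number_labels:
  assumes P: "labels X P" and fin: "finite (range X)"
  shows "cover_number P = card (range X)"
proof -
  let ?L = "(\<lambda>k. X -` {k}) ` range X"
  have card_L: "card ?L = card (range X)"
    by (intro card_image) (auto simp: inj_on_def)
  have sub: "?L \<subseteq> V" if "V \<subseteq> P" "\<Union>V = UNIV" for V
  proof
    fix B assume "B \<in> ?L"
    then obtain x where B: "B = X -` {X x}"
      by auto
    obtain C where C: "C \<in> V" "x \<in> C"
      using \<open>\<Union>V = UNIV\<close> by blast
    then have "C = B"
      using P \<open>V \<subseteq> P\<close> unfolding labels_def B by blast
    then show "B \<in> V"
      using C by simp
  qed
  show ?thesis
    unfolding cover_number_def
  proof (rule Least_equality)
    show "\<exists>V\<subseteq>P. finite V \<and> \<Union>V = UNIV \<and> card V = card (range X)"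
      using P fin card_L by (intro exI[of _ ?L]) (auto simp: labels_def)
  next
    fix k assume "\<exists>V\<subseteq>P. finite V \<and> \<Union>V = UNIV \<and> card V = k"
    then show "card (range X) \<le> k"
      using sub card_L card_mono by metis
  qed
qed

subsection \<open>Entropy of labellings\<close>

definition label_entropy :: "'x measure \<Rightarrow> ('x \<Rightarrow> 'k) \<Rightarrow> real" where
  "label_entropy M X = - (\<Sum>k\<in>range X. measure M (X -` {k}) * ln (measure M (X -` {k})))"

lemma shannon_entropy_labels:
  assumes "labels X P" "finite (range X)"
  shows "shannon_entropy M P = label_entropy M X"
proof -
  let ?h = "\<lambda>B. measure M B * ln (measure M B)"
  have "finite P"
    using labels_imp_diff_empty[OF assms(1)] assms(2) by (metis finite_imageI finite_Diff2 finite.simps)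
  then have "sum ?h P = sum ?h (P - {{}})"
    by (intro sum.mono_neutral_right) auto
  also have "\<dots> = (\<Sum>k\<in>range X. ?h (X -` {k}))"
    unfolding labels_imp_diff_empty[OF assms(1)]
    by (subst sum.reindex) (auto simp: inj_on_def)
  finally show ?thesis
    by (simp add: shannon_entropy_def label_entropy_def)
qed

text \<open>Values that are never taken contribute 0. This puts labellings with different ranges
  over one common index set.\<close>

lemma label_entropy_superset:
  assumes "finite K" "range X \<subseteq> K"
  shows "label_entropy M X = - (\<Sum>k\<in>K. measure M (X -` {k}) * ln (measure M (X -` {k})))"
proof -
  have "X -` {k} = {}" if "k \<notin> range X" for k
    using that by auto
  then show ?thesis
    unfolding label_entropy_def using assms by (subst sum.mono_neutral_left) auto
qed

text \<open>Entropy sees only the partition into level sets, not the names of the labels. This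
  justifies every regrouping of tuples below.\<close>

lemma label_entropy_cong:
  assumes "\<And>x y. X x = X y \<longleftrightarrow> Y x = Y y" "finite (range X)"
  shows "label_entropy M X = label_entropy M Y"
proof -
  have "Y -` {Y x} = X -` {X x}" for x
    using assms(1) by auto
  then have lab: "labels X ((\<lambda>k. Y -` {k}) ` range Y)"
    by (auto simp: labels_def assms(1))
  have "range Y = (\<lambda>k. Y (inv X k)) ` range X"
  proof -
    have "Y (inv X (X x)) = Y x" for x
      using assms(1)[of "inv X (X x)" x] by (simp add: f_inv_into_f)
    then show ?thesis
      by (auto simp: image_iff)
  qed
  then have "finite (range Y)"
    using assms(2) by simp
  then show ?thesis
    using shannon_entropy_labels[OF lab assms(2)] shannon_entropy_labels[OF labels_level_sets] by metis
qed

section \<open>Shannon inequalities for finite labellings\<close>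

locale full_prob_space = prob_space +
  assumes space_UNIV [simp]: "space M = UNIV"
begin

abbreviation H :: "('a \<Rightarrow> 'k) \<Rightarrow> real" where
  "H \<equiv> label_entropy M"

lemma simple_function_finite_range: "simple_function M X \<Longrightarrow> finite (range X)"
  by (auto simp: simple_function_def)

lemma sets_vimage: "simple_function M X \<Longrightarrow> X -` S \<in> sets M"
  using simple_functionD(2)[of M X S] by simp

text \<open>Base \<open>exp 1\<close> turns the information-theoretic entropy into the one with
  natural logarithm, so its inequalities carry over.\<close>

lemma H_eq_entropy:
  assumes "simple_function M X"
  shows "H X = entropy (exp 1) (count_space (range X)) X"
proof -
  interpret information_space M "exp 1"
    by unfold_locales simp
  show ?thesis
    using entropy_simple_distributed[OF simple_distributedI[OF assms measure_nonneg refl]]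
    by (simp add: label_entropy_def log_def)
qed

lemma H_nonneg:
  "0 \<le> H X"
proof -
  have "measure M (X -` {k}) * ln (measure M (X -` {k})) \<le> 0" for k
    by (cases "measure M (X -` {k}) = 0")
       (auto intro!: mult_nonneg_nonpos simp: ln_le_zero_iff zero_less_measure_iff)
  then show ?thesis
    by (simp add: label_entropy_def sum_nonpos)
qed

lemma H_le_ln_card:
  assumes "simple_function M X"
  shows "H X \<le> ln (card (range X))"
proof -
  interpret information_space M "exp 1"
    by unfold_locales simp
  show ?thesis
    using entropy_le_card[OF simple_distributedI[OF assms measure_nonneg refl]]
    by (simp add: H_eq_entropy[OF assms] log_def)
qed

lemma H_mono:
  assumes "simple_function M X" "\<And>x y. X x = X y \<Longrightarrow> Y x = Y y"
  shows "H Y \<le> H X"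
proof -
  interpret information_space M "exp 1"
    by unfold_locales simp
  define f where "f k = Y (inv X k)" for k
  have f: "f (X x) = Y x" for x
    unfolding f_def by (rule assms(2)) (simp add: f_inv_into_f)
  then have "f \<circ> X = Y"
    by auto
  then show ?thesis
    using entropy_data_processing[OF assms(1), of f] assms(1) simple_function_compose[OF assms(1), of f]
    by (simp add: H_eq_entropy)
qed

text \<open>Group the values of \<open>X\<close> by the fibres of \<open>f\<close>: the event
  \<open>Y = l\<close> is the disjoint union of the events \<open>X = k\<close> with
  \<open>f k = l\<close>. Used to sum out coordinates of a joint distribution.\<close>

lemma sum_marginal:
  assumes "simple_function M X" "\<And>x. f (X x) = Y x"
  shows "(\<Sum>k\<in>range X. prob (X -` {k}) * g (f k)) = (\<Sum>l\<in>range Y. prob (Y -` {l}) * g l)"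
proof -
  have Y: "range Y = f ` range X"
    using assms(2) by (auto simp: image_iff)
  then have fin: "finite (range X)" "finite (range Y)"
    using simple_function_finite_range[OF assms(1)] by auto
  have "prob (Y -` {l}) = (\<Sum>k\<in>{k\<in>range X. f k = l}. prob (X -` {k}))" for l
  proof -
    have "Y -` {l} = (\<Union>k\<in>{k\<in>range X. f k = l}. X -` {k})"
      using assms(2) by (auto simp: vimage_def) (metis assms(2))
    moreover have "prob (\<Union>k\<in>{k\<in>range X. f k = l}. X -` {k}) = (\<Sum>k\<in>{k\<in>range X. f k = l}. prob (X -` {k}))"
      by (rule finite_measure_finite_Union)
         (use fin assms(1) in \<open>auto simp: sets_vimage disjoint_family_on_def\<close>)
    ultimately show ?thesis
      by simp
  qed
  then have "(\<Sum>l\<in>range Y. prob (Y -` {l}) * g l) =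
      (\<Sum>l\<in>f ` range X. \<Sum>k\<in>{k\<in>range X. f k = l}. prob (X -` {k}) * g (f k))"
    unfolding Y by (auto simp: sum_distrib_right intro!: sum.cong)
  also have "\<dots> = (\<Sum>k\<in>range X. prob (X -` {k}) * g (f k))"
    by (rule sum.group) (use fin in auto)
  finally show ?thesis ..
qed

text \<open>This is nonnegativity of the conditional mutual information of \<open>X\<close> and
  \<open>Y\<close> given \<open>Z\<close>, expanded into four entropies.\<close>

lemma H_submodular:
  assumes X: "simple_function M X" and Y: "simple_function M Y" and Z: "simple_function M Z"
  shows "H (\<lambda>x. (X x, Y x, Z x)) + H Z \<le> H (\<lambda>x. (X x, Z x)) + H (\<lambda>x. (Y x, Z x))"
proof -
  interpret information_space M "exp 1"
    by unfold_locales simp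
  let ?V = "\<lambda>x. (X x, Y x, Z x)"
  note V = simple_function_Pair[OF X simple_function_Pair[OF Y Z]]
  note sd = simple_distributedI[OF _ measure_nonneg refl]
  define p where "p v = prob (?V -` {v})" for v
  define pz where "pz z = prob (Z -` {z})" for z
  define pxz where "pxz w = prob ((\<lambda>x. (X x, Z x)) -` {w})" for w
  define pyz where "pyz w = prob ((\<lambda>x. (Y x, Z x)) -` {w})" for w
  \<comment> \<open>If \<open>p v = 0\<close>, both sides vanish; otherwise the marginals dominate
    \<open>p v\<close> and are positive, so the logarithm of the quotient splits.\<close>
  have split: "p v * log (exp 1) (p v / (pxz (x, z) * (pyz (y, z) / pz z))) =
     p v * ln (p v) + p v * ln (pz z) - p v * ln (pxz (x, z)) - p v * ln (pyz (y, z))"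
    if v: "v = (x, y, z)" for v x y z
  proof (cases "p v = 0")
    case False
    then have "0 < p v"
      by (simp add: p_def zero_less_measure_iff)
    moreover have "p v \<le> pz z" "p v \<le> pxz (x, z)" "p v \<le> pyz (y, z)"
      unfolding p_def pz_def pxz_def pyz_def v
      by (rule finite_measure_mono;
          use X Y Z in \<open>auto intro!: sets_vimage simple_function_Pair\<close>)+
    ultimately have "0 < p v" "0 < pz z" "0 < pxz (x, z)" "0 < pyz (y, z)"
      by linarith+
    then show ?thesis
      by (simp add: log_def ln_div ln_mult algebra_simps)
  qed simp
  have "0 \<le> (\<Sum>(x, y, z)\<in>range ?V.
      p (x, y, z) * log (exp 1) (p (x, y, z) / (pxz (x, z) * (pyz (y, z) / pz z))))"
    using conditional_mutual_information_nonneg[OF X Y Z]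
    unfolding conditional_mutual_information_eq[OF sd[OF Z] sd[OF simple_function_Pair[OF Y Z]]
       sd[OF simple_function_Pair[OF X Z]] sd[OF V]]
    by (simp add: p_def pz_def pxz_def pyz_def)
  also have "\<dots> = (\<Sum>v\<in>range ?V. p v * ln (p v) + p v * ln (pz (snd (snd v)))
      - p v * ln (pxz (fst v, snd (snd v))) - p v * ln (pyz (snd v)))"
  proof (intro sum.cong refl, goal_cases)
    case (1 v)
    obtain x y z where v: "v = (x, y, z)"
      by (cases v)
    show ?case
      using split[OF v] unfolding v by simp
  qed
  also have "\<dots> = (\<Sum>v\<in>range ?V. p v * ln (p v)) + (\<Sum>v\<in>range ?V. p v * ln (pz (snd (snd v))))
     - (\<Sum>v\<in>range ?V. p v * ln (pxz (fst v, snd (snd v)))) - (\<Sum>v\<in>range ?V. p v * ln (pyz (snd v)))"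
    by (simp add: sum.distrib sum_subtractf)
  \<comment> \<open>In each of the last three sums the logarithm depends only on a marginal, so the
    remaining coordinates can be summed out.\<close>
  also have "\<dots> = - H ?V - H Z + H (\<lambda>x. (X x, Z x)) + H (\<lambda>x. (Y x, Z x))"
    unfolding p_def
    by (subst sum_marginal[OF V, of "\<lambda>v. snd (snd v)" Z "\<lambda>z. ln (pz z)"],
        simp,
        subst sum_marginal[OF V, of "\<lambda>v. (fst v, snd (snd v))" "\<lambda>x. (X x, Z x)" "\<lambda>z. ln (pxz z)"],
        simp,
        subst sum_marginal[OF V, of snd "\<lambda>x. (Y x, Z x)" "\<lambda>z. ln (pyz z)"], simp)
       (simp add: label_entropy_def pz_def pxz_def pyz_def)
  finally show ?thesis
    by simp
qed

text \<open>Submodularity with a constant as the conditioning label.\<close>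

lemma H_subadditive:
  assumes "simple_function M X" "simple_function M Y"
  shows "H (\<lambda>x. (X x, Y x)) \<le> H X + H Y"
proof -
  have c: "simple_function M (\<lambda>x. ())"
    by simp
  have "H (\<lambda>x. (X x, Y x, ())) = H (\<lambda>x. (X x, Y x))" "H (\<lambda>x. (X x, ())) = H X"
    "H (\<lambda>x. (Y x, ())) = H Y"
    using assms by (intro label_entropy_cong; auto intro!: simple_function_finite_range simple_function_Pair)+
  then show ?thesis
    using H_submodular[OF assms c] H_nonneg[of "\<lambda>x. ()"] by simp
qed

lemma simple_function_restrict:
  assumes "finite I" "\<And>i. i \<in> I \<Longrightarrow> simple_function M (X i)"
  shows "simple_function M (\<lambda>x. restrict (\<lambda>i. X i x) I)"
  using assms
proof (induction I)
  case empty
  then show ?case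
    by simp
next
  case (insert i I)
  have *: "restrict (\<lambda>j. X j x) (insert i I) = (restrict (\<lambda>j. X j x) I)(i := X i x)" for x
    by (auto simp: fun_eq_iff)
  have "simple_function M (\<lambda>x. restrict (\<lambda>j. X j x) I)"
    by (rule insert.IH) (use insert.prems in auto)
  moreover have "simple_function M (X i)"
    using insert.prems by auto
  ultimately show ?case
    unfolding * by (rule simple_function_compose2)
qed

text \<open>This is \<open>H (X\<^sub>I | Y\<^sub>I) \<le> (\<Sum>i\<in>I. H (X\<^sub>i | Y\<^sub>i))\<close>, with \<open>H (X | Y)\<close> written as \<open>H (X, Y) - H Y\<close>; the
  inductive step is two applications of submodularity.\<close>

lemma H_restrict_le:
  assumes "finite I" "\<And>i. i \<in> I \<Longrightarrow> simple_function M (X i)" "\<And>i. i \<in> I \<Longrightarrow> simple_function M (Y i)"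
  shows "H (\<lambda>x. (restrict (\<lambda>i. X i x) I, restrict (\<lambda>i. Y i x) I)) \<le>
    H (\<lambda>x. restrict (\<lambda>i. Y i x) I) + (\<Sum>i\<in>I. H (\<lambda>x. (X i x, Y i x)) - H (Y i))"
  using assms
proof (induction I)
  case empty
  then show ?case
    by simp (rule H_mono, auto)
next
  case (insert i I)
  let ?A = "\<lambda>x. restrict (\<lambda>i. X i x) I" and ?B = "\<lambda>x. restrict (\<lambda>i. Y i x) I"
  have A: "simple_function M ?A" and B: "simple_function M ?B"
    using insert by (auto intro!: simple_function_restrict)
  have Xi: "simple_function M (X i)" and Yi: "simple_function M (Y i)"
    using insert by auto
  have "H (\<lambda>x. (restrict (\<lambda>i. X i x) (insert i I), restrict (\<lambda>i. Y i x) (insert i I))) =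
      H (\<lambda>x. (?A x, (X i x, Y i x), ?B x))"
    by (rule label_entropy_cong[symmetric])
       (use A B Xi Yi in \<open>auto intro!: simple_function_finite_range simple_function_Pair simp: restrict_eq_iff\<close>)
  moreover have "H (\<lambda>x. restrict (\<lambda>i. Y i x) (insert i I)) = H (\<lambda>x. (?B x, Y i x))"
    by (rule label_entropy_cong[symmetric])
       (use A B Xi Yi in \<open>auto intro!: simple_function_finite_range simple_function_Pair simp: restrict_eq_iff\<close>)
  moreover have "H (\<lambda>x. ((X i x, Y i x), ?B x)) = H (\<lambda>x. (X i x, ?B x, Y i x))"
    by (rule label_entropy_cong[symmetric])
       (use A B Xi Yi in \<open>auto intro!: simple_function_finite_range simple_function_Pair simp: restrict_eq_iff\<close>)
  moreover have "H (\<lambda>x. (?A x, ?B x)) \<le> H ?B + (\<Sum>i\<in>I. H (\<lambda>x. (X i x, Y i x)) - H (Y i))"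
    by (rule insert.IH) (use insert.prems in auto)
  \<comment> \<open>With \<open>A\<close>, \<open>B\<close> for the two tuples over
    \<open>I\<close>, the first instance says \<open>H (A | X i, Y i, B) \<le> H (A | B)\<close>,
    the second \<open>H (X i | B, Y i) \<le> H (X i | Y i)\<close>.\<close>
  moreover note H_submodular[OF A simple_function_Pair[OF Xi Yi] B] H_submodular[OF Xi B Yi]
  ultimately show ?case
    unfolding sum.insert[OF insert(1,2)] by linarith
qed

end

subsection \<open>Dynamical entropies as limits\<close>

text \<open>Fekete's lemma: the limit is the infimum of the quotients, shown by dividing
  \<open>n\<close> with remainder by a nearly optimal \<open>m\<close>. It guarantees that the
  \<open>lim\<close> in the entropy definitions is a genuine limit.\<close>

lemma fekete_convergent:
  fixes a :: "nat \<Rightarrow> real"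
  assumes nonneg: "\<And>n. 0 \<le> a n" and sub: "\<And>m n. a (m + n) \<le> a m + a n"
  shows "convergent (\<lambda>n. a n / real n)"
proof -
  \<comment> \<open>Index 0 is left out, since its quotient is 0 by convention and would distort the
    infimum.\<close>
  let ?S = "(\<lambda>n. a n / real n) ` {1..}"
  define L where "L = Inf ?S"
  have bdd: "bdd_below ?S"
    by (intro bdd_belowI[of _ 0]) (auto simp: nonneg)
  have lower: "L \<le> a n / real n" if "n \<ge> 1" for n
    unfolding L_def using bdd that by (intro cInf_lower) auto
  have mult: "a (q * m + s) \<le> real q * a m + a s" for q m s
  proof (induction q)
    case (Suc q)
    have "a (Suc q * m + s) \<le> a m + a (q * m + s)"
      using sub[of m "q * m + s"] by (simp add: algebra_simps)
    then show ?case
      using Suc by (simp add: algebra_simps)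
  qed simp
  have "(\<lambda>n. a n / real n) \<longlonglongrightarrow> L"
  proof (rule LIMSEQ_I)
    fix e :: real assume e: "e > 0"
    have "\<exists>y\<in>?S. y < L + e / 2"
      unfolding L_def using e by (intro cInf_lessD) auto
    then obtain m where m: "m \<ge> 1" "a m / real m < L + e / 2"
      by auto
    \<comment> \<open>\<open>B\<close> bounds \<open>a\<close> on all remainders modulo
      \<open>m\<close>; the index \<open>n0\<close> makes \<open>B / n\<close> less than the second
      \<open>e / 2\<close>.\<close>
    define B where "B = Max (a ` {..<m})"
    have B: "a s \<le> B" if "s < m" for s
      unfolding B_def using that by (intro Max_ge) auto
    obtain n0 where n0: "real n0 > 2 * B / e"
      using reals_Archimedean2 by blast
    show "\<exists>n0. \<forall>n\<ge>n0. norm (a n / real n - L) < e"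
    proof (intro exI[of _ "max 1 n0"] allI impI)
      fix n assume n: "n \<ge> max 1 n0"
      then have "real n > 2 * B / e"
        using n0 by (meson less_le_trans of_nat_le_iff max.boundedE)
      then have Bn: "B / real n < e / 2"
        using n e by (simp add: field_simps)
      have "a n \<le> real (n div m) * a m + a (n mod m)"
        using mult[of "n div m" m "n mod m"] by simp
      also have "\<dots> \<le> (real n / real m) * a m + B"
        using m B[of "n mod m"] nonneg by (intro add_mono mult_right_mono of_nat_div_le_of_nat) auto
      finally have "a n / real n \<le> a m / real m + B / real n"
        using n m by (simp add: field_simps)
      then show "norm (a n / real n - L) < e"
        using lower[of n] n m(2) Bn unfolding real_norm_def by (cases "n \<ge> 1") linarith+
    qed
  qed
  then show ?thesis
    by (rule convergentI)
qed

text \<open>The itinerary of \<open>x\<close>; owing to \<open>restrict\<close>, two itineraries are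
  equal as soon as they agree at times below \<open>N\<close>.\<close>

definition orbit :: "('x \<Rightarrow> 'x) \<Rightarrow> ('x \<Rightarrow> 'k) \<Rightarrow> nat \<Rightarrow> 'x \<Rightarrow> nat \<Rightarrow> 'k" where
  "orbit T X N x = restrict (\<lambda>i. X ((T ^^ i) x)) {..<N}"

lemma labels_dyn_join: "labels X P \<Longrightarrow> labels (orbit T X N) (dyn_join T P N)"
  unfolding orbit_def dyn_join_def by (intro labels_join labels_vimage)

lemma orbit_eq_iff: "orbit T X N x = orbit T X N y \<longleftrightarrow> (\<forall>i<N. X ((T ^^ i) x) = X ((T ^^ i) y))"
  by (auto simp: orbit_def restrict_eq_iff)

text \<open>The source of subadditivity, both for the number of itineraries and for their
  entropy.\<close>

lemma orbit_add_eq_iff: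
  "orbit T X (m + n) x = orbit T X (m + n) y \<longleftrightarrow>
    orbit T X m x = orbit T X m y \<and> orbit T X n ((T ^^ m) x) = orbit T X n ((T ^^ m) y)"
proof -
  have "(\<forall>i<m + n. Q i) \<longleftrightarrow> (\<forall>i<m. Q i) \<and> (\<forall>i<n. Q (i + m))" for Q
    by (metis add.commute add_less_cancel_left le_Suc_ex not_less trans_less_add1)
  then show ?thesis
    by (simp add: orbit_eq_iff funpow_add)
qed

lemma finite_range_orbit:
  assumes "finite (range X)"
  shows "finite (range (orbit T X N))"
proof (rule finite_subset)
  show "range (orbit T X N) \<subseteq> (\<Pi>\<^sub>E i\<in>{..<N}. range X)"
    unfolding orbit_def by (intro image_subsetI restrict_PiE_iff[THEN iffD2]) simp
qed (use assms in \<open>auto intro: finite_PiE\<close>)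

text \<open>The cover number of the dynamical join is the number of itineraries of length
  \<open>N\<close>. This number is submultiplicative, so Fekete's lemma applies to its
  logarithm.\<close>

lemma dyn_cover_entropy_labels:
  assumes "labels X P" "finite (range X)"
  shows "(\<lambda>N. ln (real (card (range (orbit T X N)))) / real N) \<longlonglongrightarrow> dyn_cover_entropy P T"
proof -
  let ?c = "\<lambda>N. card (range (orbit T X N))"
  have pos: "?c N > 0" for N
    using finite_range_orbit[OF assms(2)] by (simp add: card_gt_0_iff)
  have sub: "?c (m + n) \<le> ?c m * ?c n" for m n
  proof -
    let ?g = "\<lambda>x. (orbit T X m x, orbit T X n ((T ^^ m) x))"
    have fin: "finite (range (orbit T X m) \<times> range (orbit T X n))"
      using finite_range_orbit[OF assms(2)] by simp
    have "range (orbit T X (m + n)) = (\<lambda>w. orbit T X (m + n) (inv ?g w)) ` range ?g"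
    proof -
      have "orbit T X (m + n) (inv ?g (?g x)) = orbit T X (m + n) x" for x
        unfolding orbit_add_eq_iff using f_inv_into_f[of "?g x" ?g UNIV] by simp
      then show ?thesis
        by (auto simp: image_iff)
    qed
    then have "?c (m + n) \<le> card (range ?g)"
      using finite_subset[OF _ fin, of "range ?g"] by (simp add: card_image_le image_subset_iff)
    also have "\<dots> \<le> card (range (orbit T X m) \<times> range (orbit T X n))"
      by (rule card_mono[OF fin]) auto
    finally show ?thesis
      by (simp add: card_cartesian_product)
  qed
  have "convergent (\<lambda>N. ln (real (?c N)) / real N)"
  proof (rule fekete_convergent)
    fix m n
    show "0 \<le> ln (real (?c m))"
      using pos[of m] by simp
    have "ln (real (?c (m + n))) \<le> ln (real (?c m * ?c n))"
      using sub[of m n] pos[of "m + n"] by (intro ln_mono) (simp_all only: of_nat_le_iff of_nat_0_less_iff)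
    also have "\<dots> = ln (real (?c m)) + ln (real (?c n))"
      using pos[of m] pos[of n] by (simp add: ln_mult)
    finally show "ln (real (?c (m + n))) \<le> ln (real (?c m)) + ln (real (?c n))" .
  qed
  moreover have "cover_entropy (dyn_join T P N) = ln (real (?c N))" for N
    unfolding cover_entropy_def
    using cover_number_labels[OF labels_dyn_join[OF assms(1)] finite_range_orbit[OF assms(2)]] by simp
  ultimately show ?thesis
    by (simp add: dyn_cover_entropy_def convergent_LIMSEQ_iff)
qed

section \<open>Entropy of itineraries under a measure-preserving map\<close>

context full_prob_space
begin

lemma simple_function_comp_measurable:
  assumes "simple_function M X" "S \<in> M \<rightarrow>\<^sub>M M"
  shows "simple_function M (\<lambda>x. X (S x))"
proof -
  have "(\<lambda>x. X (S x)) -` {k} \<in> sets M" for k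
    using measurable_sets[OF assms(2) sets_vimage[OF assms(1), of "{k}"]] by (simp add: vimage_def)
  moreover have "range (\<lambda>x. X (S x)) \<subseteq> range X"
    by auto
  ultimately show ?thesis
    using simple_function_finite_range[OF assms(1)] by (auto simp: simple_function_def intro: finite_subset)
qed

text \<open>Invariance preserves the probability of each level set. As \<open>X\<close> after
  \<open>T\<close> may take fewer values than \<open>X\<close>, both sums are taken over
  \<open>range X\<close>.\<close>

lemma label_entropy_comp:
  assumes "simple_function M X" "T \<in> M \<rightarrow>\<^sub>M M" "distr M M T = M"
  shows "H (\<lambda>x. X (T x)) = H X"
proof -
  have "prob ((\<lambda>x. X (T x)) -` {k}) = prob (X -` {k})" for k
  proof -
    have "measure (distr M M T) (X -` {k}) = prob (T -` (X -` {k}) \<inter> space M)"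
      by (rule measure_distr) (use assms in \<open>auto simp: sets_vimage\<close>)
    then show ?thesis
      using assms(3) by (simp add: vimage_def)
  qed
  moreover have "range (\<lambda>x. X (T x)) \<subseteq> range X"
    by auto
  ultimately show ?thesis
    using label_entropy_superset[of "range X" "\<lambda>x. X (T x)" M] simple_function_finite_range[OF assms(1)]
    by (simp add: label_entropy_def)
qed

end

locale measure_preserving_map = full_prob_space M for M :: "'a measure" +
  fixes T :: "'a \<Rightarrow> 'a"
  assumes measurable_T: "T \<in> M \<rightarrow>\<^sub>M M" and distr_T: "distr M M T = M"
begin

lemma measurable_funpow: "T ^^ n \<in> M \<rightarrow>\<^sub>M M"
  by (induction n) (use measurable_T in \<open>auto intro: measurable_comp\<close>)

lemma distr_funpow: "distr M M (T ^^ n) = M"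
proof (induction n)
  case (Suc n)
  have "distr M M (T ^^ Suc n) = distr (distr M M (T ^^ n)) M T"
    by (subst distr_distr) (auto intro: measurable_funpow measurable_T)
  then show ?case
    by (simp only: Suc distr_T)
qed (simp add: distr_id2 id_def)

lemma simple_function_orbit:
  assumes "simple_function M X"
  shows "simple_function M (orbit T X N)"
  unfolding orbit_def
  by (intro simple_function_restrict simple_function_comp_measurable[OF assms measurable_funpow]) simp

text \<open>An itinerary of length \<open>m + n\<close> splits at time \<open>m\<close>; by
  invariance its second half has the entropy of an itinerary of length \<open>n\<close>.
  Subadditivity and Fekete's lemma finish.\<close>

lemma dyn_entropy_labels:
  assumes P: "labels X P" and X: "simple_function M X"
  shows "(\<lambda>N. H (orbit T X N) / real N) \<longlonglongrightarrow> dyn_entropy M P T"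
proof -
  have "convergent (\<lambda>N. H (orbit T X N) / real N)"
  proof (rule fekete_convergent)
    fix m n
    show "0 \<le> H (orbit T X m)"
      by (rule H_nonneg)
    have "H (orbit T X (m + n)) = H (\<lambda>x. (orbit T X m x, orbit T X n ((T ^^ m) x)))"
    proof (rule label_entropy_cong)
      show "finite (range (orbit T X (m + n)))"
        by (intro simple_function_finite_range simple_function_orbit X)
    qed (simp only: orbit_add_eq_iff prod.inject)
    also have "\<dots> \<le> H (orbit T X m) + H (\<lambda>x. orbit T X n ((T ^^ m) x))"
      by (intro H_subadditive simple_function_orbit X
          simple_function_comp_measurable[OF simple_function_orbit[OF X] measurable_funpow])
    also have "H (\<lambda>x. orbit T X n ((T ^^ m) x)) = H (orbit T X n)"
      by (intro label_entropy_comp simple_function_orbit X measurable_funpow distr_funpow)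
    finally show "H (orbit T X (m + n)) \<le> H (orbit T X m) + H (orbit T X n)" .
  qed
  moreover have "shannon_entropy M (dyn_join T P N) = H (orbit T X N)" for N
    by (intro shannon_entropy_labels labels_dyn_join P simple_function_finite_range simple_function_orbit X)
  ultimately show ?thesis
    by (simp add: dyn_entropy_def convergent_LIMSEQ_iff)
qed

text \<open>The entropy of the itineraries is at most the logarithm of their number; divide by
  \<open>N\<close> and pass to the limit.\<close>

lemma dyn_entropy_le_dyn_cover_entropy:
  assumes "labels X P" "simple_function M X"
  shows "dyn_entropy M P T \<le> dyn_cover_entropy P T"
  using dyn_entropy_labels[OF assms]
    dyn_cover_entropy_labels[OF assms(1) simple_function_finite_range[OF assms(2)], of T]
  by (rule LIMSEQ_le) (auto intro!: divide_right_mono H_le_ln_card simple_function_orbit assms)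

lemma dyn_entropy_le_of_orbits:
  assumes "labels X P" "simple_function M X" "labels Y Q" "simple_function M Y"
    and "\<And>N. H (orbit T X N) \<le> H (orbit T Y N) + real N * c"
  shows "dyn_entropy M P T \<le> dyn_entropy M Q T + c"
proof (rule LIMSEQ_le)
  show "(\<lambda>N. H (orbit T X N) / real N) \<longlonglongrightarrow> dyn_entropy M P T"
    by (intro dyn_entropy_labels assms)
  show "(\<lambda>N. H (orbit T Y N) / real N + c) \<longlonglongrightarrow> dyn_entropy M Q T + c"
    by (intro tendsto_add dyn_entropy_labels assms tendsto_const)
  have "H (orbit T X N) / real N \<le> H (orbit T Y N) / real N + c" if "N \<ge> 1" for N
    using assms(5)[of N] that by (simp add: field_simps)
  then show "\<exists>n0. \<forall>N\<ge>n0. H (orbit T X N) / real N \<le> H (orbit T Y N) / real N + c"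
    by blast
qed

lemma simple_function_comp_iterate:
  assumes "simple_function M X" "S \<in> M \<rightarrow>\<^sub>M M"
  shows "simple_function M (\<lambda>x. X (S ((T ^^ i) x)))"
  using simple_function_comp_measurable[OF simple_function_comp_measurable[OF assms] measurable_funpow] .

lemma label_entropy_comp_iterate:
  assumes "simple_function M X" "S \<in> M \<rightarrow>\<^sub>M M" "distr M M S = M"
  shows "H (\<lambda>x. X (S ((T ^^ i) x))) = H X"
  using label_entropy_comp[OF simple_function_comp_measurable[OF assms(1,2)] measurable_funpow distr_funpow, of i]
    label_entropy_comp[OF assms] by simp

text \<open>Frame joins are labelled by families \<open>X \<circ> S v\<close>, where \<open>S v\<close> is a shift.\<close>

lemma H_orbit_family_le:
  fixes X Y :: "'a \<Rightarrow> 'k"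
  assumes I: "finite I" and X: "simple_function M X" and Y: "simple_function M Y"
    and S: "\<And>v. v \<in> I \<Longrightarrow> S v \<in> M \<rightarrow>\<^sub>M M" "\<And>v. v \<in> I \<Longrightarrow> distr M M (S v) = M"
  shows "H (orbit T (\<lambda>x. restrict (\<lambda>v. X (S v x)) I) N) \<le>
    H (orbit T (\<lambda>x. restrict (\<lambda>v. Y (S v x)) I) N)
      + real N * (real (card I) * (H (\<lambda>x. (X x, Y x)) - H Y))"
proof -
  \<comment> \<open>Indexing by pairs of a time and a member of \<open>I\<close> flattens the
    itinerary of a tuple into a single family, to which \<open>H_restrict_le\<close>
    applies.\<close>
  let ?J = "{..<N} \<times> I"
  let ?X = "\<lambda>j x. X (S (snd j) ((T ^^ fst j) x))" and ?Y = "\<lambda>j x. Y (S (snd j) ((T ^^ fst j) x))"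
  let ?XJ = "\<lambda>x. restrict (\<lambda>j. ?X j x) ?J" and ?YJ = "\<lambda>x. restrict (\<lambda>j. ?Y j x) ?J"
  have J: "finite ?J"
    using I by simp
  note XY = simple_function_Pair[OF X Y]
  have sf: "simple_function M (?X j)" "simple_function M (?Y j)" if "j \<in> ?J" for j
    using that by (auto intro!: simple_function_comp_iterate X Y S)
  \<comment> \<open>Invariance under \<open>T\<close> and \<open>S v\<close> gives every index the
    same conditional entropy.\<close>
  have cond_eq: "H (\<lambda>x. (?X j x, ?Y j x)) - H (?Y j) = H (\<lambda>x. (X x, Y x)) - H Y" if "j \<in> ?J" for j
    using that label_entropy_comp_iterate[OF XY S(1) S(2), of "snd j" "fst j"]
      label_entropy_comp_iterate[OF Y S(1) S(2), of "snd j" "fst j"] by auto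
  have orbit_cong: "H (orbit T (\<lambda>x. restrict (\<lambda>v. Z (S v x)) I) N) =
      H (\<lambda>x. restrict (\<lambda>j. Z (S (snd j) ((T ^^ fst j) x))) ?J)" if "simple_function M Z"
    for Z :: "'a \<Rightarrow> 'k"
  proof (rule label_entropy_cong[symmetric])
    show "finite (range (\<lambda>x. restrict (\<lambda>j. Z (S (snd j) ((T ^^ fst j) x))) ?J))"
      by (rule simple_function_finite_range, rule simple_function_restrict)
         (use that I in \<open>auto intro!: simple_function_comp_iterate S\<close>)
  qed (auto simp: orbit_eq_iff restrict_eq_iff)
  have "H (orbit T (\<lambda>x. restrict (\<lambda>v. X (S v x)) I) N) = H ?XJ"
    by (rule orbit_cong[OF X])
  also have "\<dots> \<le> H (\<lambda>x. (?XJ x, ?YJ x))"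
    by (rule H_mono) (auto intro!: simple_function_Pair simple_function_restrict J sf)
  also have "\<dots> \<le> H ?YJ + (\<Sum>j\<in>?J. H (\<lambda>x. (?X j x, ?Y j x)) - H (?Y j))"
    by (rule H_restrict_le[OF J sf])
  also have "(\<Sum>j\<in>?J. H (\<lambda>x. (?X j x, ?Y j x)) - H (?Y j)) =
      real N * (real (card I) * (H (\<lambda>x. (X x, Y x)) - H Y))"
    by (simp only: cond_eq sum_constant card_cartesian_product card_lessThan of_nat_mult mult.assoc cong: sum.cong)
  also have "H ?YJ = H (orbit T (\<lambda>x. restrict (\<lambda>v. Y (S v x)) I) N)"
    by (rule orbit_cong[OF Y, symmetric])
  finally show ?thesis .
qed

end

subsection \<open>Approximation by clopen partitions\<close>

text \<open>\<open>U\<close> and its complement are both unions of cylinders over the finite set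
  \<open>J\<close>.\<close>

lemma clopen_if_finite_coordinates:
  fixes U :: "('i \<Rightarrow> 'b::discrete_topology) set"
  assumes J: "finite J" and U: "\<And>x y. x \<in> U \<Longrightarrow> (\<And>j. j \<in> J \<Longrightarrow> x j = y j) \<Longrightarrow> y \<in> U"
  shows "open U" "closed U"
proof -
  have *: "open V" if V: "\<And>x y. x \<in> V \<Longrightarrow> (\<And>j. j \<in> J \<Longrightarrow> x j = y j) \<Longrightarrow> y \<in> V"
    for V :: "('i \<Rightarrow> 'b) set"
  proof (subst open_subopen, intro ballI)
    fix x assume "x \<in> V"
    have "open {y. \<forall>j\<in>J. y j \<in> {x j}}"
      using J by (intro product_topology_basis'[of J "\<lambda>j. {x j}" "\<lambda>j. j"]) (auto intro: discrete_topology_class.open_discrete)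
    moreover have "{y. \<forall>j\<in>J. y j \<in> {x j}} \<subseteq> V"
      using V[OF \<open>x \<in> V\<close>] by auto
    ultimately show "\<exists>T. open T \<and> x \<in> T \<and> T \<subseteq> V"
      by (intro exI[of _ "{y. \<forall>j\<in>J. y j \<in> {x j}}"]) auto
  qed
  show "open U"
    by (rule *) (rule U)
  have "open (- U)"
  proof (rule *)
    fix x y assume "x \<in> - U" "\<And>j. j \<in> J \<Longrightarrow> x j = y j"
    then show "y \<in> - U"
      using U[of y x] by auto
  qed
  then show "closed U"
    by (simp add: closed_def)
qed

lemma finite_square: "finite (square n)"
  by (simp add: square_def)

lemma square_mono: "m \<le> n \<Longrightarrow> square m \<subseteq> square n"
  by (auto simp: square_def)

lemma mem_square_self: "u \<in> square (nat (max \<bar>fst u\<bar> \<bar>snd u\<bar>))"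
  by (cases u) (auto simp: square_def)

lemma open_config_contains_cylinder:
  fixes U :: "'a::topological_space config set"
  assumes "open U" "x \<in> U"
  shows "\<exists>n. \<forall>y. (\<forall>u\<in>square n. y u = x u) \<longrightarrow> y \<in> U"
proof -
  have "openin (product_topology (\<lambda>i::int \<times> int. euclidean) UNIV) U"
    using assms(1) by (simp add: open_fun_def)
  from product_topology_open_contains_basis[OF this assms(2)] obtain X where
    X: "x \<in> Pi\<^sub>E UNIV X" "finite {i. X i \<noteq> UNIV}" "Pi\<^sub>E UNIV X \<subseteq> U"
    by auto
  \<comment> \<open>A basic open set constrains finitely many coordinates, so one square holds them
    all; the inserted 0 covers the case of no constraint.\<close>
  define n where "n = Max (insert 0 ((\<lambda>u. nat (max \<bar>fst u\<bar> \<bar>snd u\<bar>)) ` {i. X i \<noteq> UNIV}))"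
  have sq: "u \<in> square n" if "X u \<noteq> UNIV" for u
  proof -
    have "nat (max \<bar>fst u\<bar> \<bar>snd u\<bar>) \<le> n"
      unfolding n_def using X(2) that by (intro Max_ge) auto
    then show ?thesis
      using mem_square_self square_mono by blast
  qed
  have "y \<in> U" if "\<forall>u\<in>square n. y u = x u" for y
  proof -
    have "y u \<in> X u" for u
    proof (cases "X u = UNIV")
      case False
      then show ?thesis
        using X(1) sq[of u] that by (metis PiE_mem UNIV_I)
    qed simp
    then show ?thesis
      using X(3) by auto
  qed
  then show ?thesis
    by blast
qed

text \<open>The sets that can be approximated to every precision form a sigma-algebra containing the
  open sets.\<close>

lemma clopen_approximation:
  fixes \<mu> :: "'a::discrete_topology config measure"
  assumes "prob_space \<mu>" and sets_\<mu>: "sets \<mu> = sets borel" and B: "B \<in> sets borel" and "0 < e"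
  shows "\<exists>U. open U \<and> closed U \<and> measure \<mu> ((B - U) \<union> (U - B)) < e"
proof -
  interpret prob_space \<mu>
    by fact
  have [simp]: "space \<mu> = UNIV"
    using sets_eq_imp_space_eq[OF sets_\<mu>] by simp
  have clopen_sets: "U \<in> sets \<mu>" if "open U" for U
    using that by (simp add: sets_\<mu>)
  have sets_borel: "C \<in> sets \<mu>" if "C \<in> sigma_sets UNIV {S. open S}" for C
    using that by (simp add: sets_\<mu> sets_borel)
  \<comment> \<open>The precision is quantified inside the induction, because the union case needs
    its hypothesis at a smaller one.\<close>
  have "\<forall>e>0. \<exists>U. open U \<and> closed U \<and> measure \<mu> ((B - U) \<union> (U - B)) < e"
    using B unfolding Borel_Space.sets_borel
  proof (induction rule: sigma_sets.induct)
    case (Basic V)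
    then have "open V"
      by simp
    \<comment> \<open>The union of all cylinders over \<open>square n\<close> inside
      \<open>V\<close>; these clopen sets increase to \<open>V\<close>.\<close>
    define U where "U n = {x. \<forall>y. (\<forall>u\<in>square n. y u = x u) \<longrightarrow> y \<in> V}" for n
    have clopen: "open (U n)" "closed (U n)" for n
      by (rule clopen_if_finite_coordinates[OF finite_square[of n]], auto simp: U_def)+
    have "incseq U"
      unfolding incseq_def U_def using square_mono by blast
    have UV: "(\<Union>n. U n) = V"
      using open_config_contains_cylinder[OF \<open>open V\<close>] by (auto simp: U_def)
    have "(\<lambda>n. measure \<mu> (U n)) \<longlonglongrightarrow> measure \<mu> V"
      using finite_Lim_measure_incseq[of U] \<open>incseq U\<close> clopen clopen_sets UV by auto
    show ?case
    proof (intro allI impI)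
      fix e :: real assume "0 < e"
      with \<open>(\<lambda>n. measure \<mu> (U n)) \<longlonglongrightarrow> measure \<mu> V\<close>
      have "eventually (\<lambda>n. measure \<mu> V - e < measure \<mu> (U n)) sequentially"
        by (intro order_tendstoD) auto
      then obtain n where n: "measure \<mu> V - e < measure \<mu> (U n)"
        by (auto simp: eventually_sequentially)
      have "U n \<subseteq> V"
        using UV by auto
      then have "(V - U n) \<union> (U n - V) = V - U n"
        by auto
      moreover have "measure \<mu> (V - U n) = measure \<mu> V - measure \<mu> (U n)"
        using \<open>U n \<subseteq> V\<close> clopen clopen_sets \<open>open V\<close> by (intro finite_measure_Diff) auto
      ultimately show "\<exists>U. open U \<and> closed U \<and> measure \<mu> ((V - U) \<union> (U - V)) < e"
        using clopen n by (intro exI[of _ "U n"]) auto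
    qed
  next
    case Empty
    show ?case
      by (auto intro!: exI[of _ "{}"])
  next
    case (Compl C)
    show ?case
    proof (intro allI impI)
      fix e :: real assume "0 < e"
      then obtain U where "open U" "closed U" "measure \<mu> ((C - U) \<union> (U - C)) < e"
        using Compl.IH by blast
      moreover have "((UNIV - C) - (- U)) \<union> ((- U) - (UNIV - C)) = (C - U) \<union> (U - C)"
        by auto
      ultimately show "\<exists>U. open U \<and> closed U \<and> measure \<mu> ((UNIV - C - U) \<union> (U - (UNIV - C))) < e"
        by (intro exI[of _ "- U"]) auto
    qed
  next
    case (Union C)
    have C: "C i \<in> sets \<mu>" for i
      using Union.hyps sets_borel by blast
    show ?case
    proof (intro allI impI)
      fix e :: real assume "0 < e"
      \<comment> \<open>Only finite unions keep closedness, so the union is first truncated at a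
        cost below \<open>e / 2\<close>. The \<open>n\<close> approximations then cost at most
        \<open>n * d \<le> e / 2\<close>; \<open>Suc n\<close> in \<open>d\<close> avoids division
        by 0.\<close>
      let ?C = "\<lambda>n. \<Union>i<n. C i"
      have "(\<lambda>n. measure \<mu> (?C n)) \<longlonglongrightarrow> measure \<mu> (\<Union>n. ?C n)"
        by (rule finite_Lim_measure_incseq) (use C in \<open>auto simp: incseq_def intro: less_le_trans\<close>)
      moreover have UC: "(\<Union>n. ?C n) = (\<Union>i. C i)"
        by auto
      ultimately have "eventually (\<lambda>n. measure \<mu> (\<Union>i. C i) - e / 2 < measure \<mu> (?C n)) sequentially"
        using \<open>0 < e\<close> by (intro order_tendstoD) auto
      then obtain n where n: "measure \<mu> (\<Union>i. C i) - e / 2 < measure \<mu> (?C n)"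
        by (auto simp: eventually_sequentially)
      define d where "d = e / (2 * real (Suc n))"
      have "d > 0"
        using \<open>0 < e\<close> by (simp add: d_def)
      then have "\<forall>i. \<exists>U. open U \<and> closed U \<and> measure \<mu> ((C i - U) \<union> (U - C i)) < d"
        using Union.IH by blast
      then obtain U where U: "\<And>i. open (U i)" "\<And>i. closed (U i)"
          "\<And>i. measure \<mu> ((C i - U i) \<union> (U i - C i)) < d"
        by metis
      let ?U = "\<Union>i<n. U i" and ?D = "\<lambda>i. (C i - U i) \<union> (U i - C i)"
      have D: "?D i \<in> sets \<mu>" for i
        using C U clopen_sets by auto
      have "measure \<mu> (((\<Union>i. C i) - ?U) \<union> (?U - (\<Union>i. C i)))
          \<le> measure \<mu> (((\<Union>i. C i) - ?C n) \<union> (\<Union>i<n. ?D i))"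
        using C D by (intro finite_measure_mono) auto
      also have "\<dots> \<le> measure \<mu> ((\<Union>i. C i) - ?C n) + measure \<mu> (\<Union>i<n. ?D i)"
        using C D by (intro measure_Un_le) auto
      also have "measure \<mu> ((\<Union>i. C i) - ?C n) = measure \<mu> (\<Union>i. C i) - measure \<mu> (?C n)"
        using C by (intro finite_measure_Diff) auto
      also have "measure \<mu> (\<Union>i<n. ?D i) \<le> (\<Sum>i<n. measure \<mu> (?D i))"
        using D by (intro finite_measure_subadditive_finite) auto
      also have "\<dots> \<le> (\<Sum>i<n. d)"
        using U(3) by (intro sum_mono) (auto intro: less_imp_le)
      also have "\<dots> \<le> e / 2"
        using \<open>0 < e\<close> by (simp add: d_def field_simps)
      finally have "measure \<mu> (((\<Union>i. C i) - ?U) \<union> (?U - (\<Union>i. C i))) < e"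
        using n by simp
      then show "\<exists>U. open U \<and> closed U \<and> measure \<mu> (((\<Union>i. C i) - U) \<union> (U - (\<Union>i. C i))) < e"
        using U by (intro exI[of _ ?U]) auto
    qed
  qed
  then show ?thesis
    using \<open>0 < e\<close> by blast
qed

text \<open>Approximate each level set of \<open>X\<close> by a clopen \<open>U k\<close> and let
  \<open>Y\<close> depend only on which \<open>U k\<close> contain the point. Outside the symmetric
  differences only the one with \<open>k = X x\<close> does, so \<open>Y\<close> agrees with
  \<open>X\<close> there.\<close>

lemma clopen_label_approximation:
  fixes \<mu> :: "'a::discrete_topology config measure" and X :: "'a config \<Rightarrow> 'k"
  assumes "prob_space \<mu>" and sets_\<mu>: "sets \<mu> = sets borel" and X: "simple_function \<mu> X" and "0 < e"
  shows "\<exists>Y :: 'a config \<Rightarrow> 'k. range Y \<subseteq> range X \<and> (\<forall>k. open (Y -` {k})) \<and> measure \<mu> {x. X x \<noteq> Y x} < e"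
proof -
  interpret full_prob_space \<mu>
    using assms(1) sets_eq_imp_space_eq[OF sets_\<mu>] by (simp add: full_prob_space_def full_prob_space_axioms_def)
  let ?K = "range X"
  have fin: "finite ?K"
    by (rule simple_function_finite_range[OF X])
  then have pos: "card ?K > 0"
    by (simp add: card_gt_0_iff)
  have "\<forall>k. \<exists>U. open U \<and> closed U \<and> measure \<mu> ((X -` {k} - U) \<union> (U - X -` {k})) < e / real (card ?K)"
    using sets_vimage[OF X] sets_\<mu> \<open>0 < e\<close> pos
    by (intro allI clopen_approximation assms(1,2)) auto
  then obtain U where U: "\<And>k. open (U k)" "\<And>k. closed (U k)"
      "\<And>k. measure \<mu> ((X -` {k} - U k) \<union> (U k - X -` {k})) < e / real (card ?K)"
    by metis
  \<comment> \<open>\<open>g\<close> selects a label from a membership pattern. On a singleton the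
    choice is forced; \<open>X undefined\<close> merely supplies a value in \<open>range X\<close>
    for points in no \<open>U k\<close>.\<close>
  define g where "g S = (if S = {} then X undefined else SOME k. k \<in> S)" for S :: "'k set"
  have g_single: "g {k} = k" for k
    by (simp add: g_def)
  define Z where "Z x = {k \<in> ?K. x \<in> U k}" for x
  define Y where "Y x = g (Z x)" for x
  have "range Y \<subseteq> ?K"
  proof clarify
    fix x
    have "Z x \<subseteq> ?K"
      by (auto simp: Z_def)
    then show "Y x \<in> ?K"
      unfolding Y_def g_def using some_in_eq[of "Z x"] by auto
  qed
  moreover have "open (Y -` {k})" for k
  proof -
    \<comment> \<open>A set of constant pattern is a finite intersection of sets \<open>U k\<close>
      and complements, all of them clopen.\<close>
    have "open (Z -` {S})" for S
    proof (cases "S \<subseteq> ?K")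
      case True
      then have Z: "Z x = S \<longleftrightarrow> (\<forall>k\<in>?K. x \<in> U k \<longleftrightarrow> k \<in> S)" for x
        unfolding Z_def by blast
      have if_mem: "x \<in> (if k \<in> S then U k else - U k) \<longleftrightarrow> (x \<in> U k \<longleftrightarrow> k \<in> S)" for x k
        by simp
      have "Z -` {S} = (\<Inter>k\<in>?K. if k \<in> S then U k else - U k)"
        by (rule set_eqI) (simp only: vimage_singleton_eq INT_iff Z if_mem)
      moreover have "open (\<Inter>k\<in>?K. if k \<in> S then U k else - U k)"
        using fin U(1,2) by (intro open_INT) (auto intro: open_Compl)
      ultimately show ?thesis
        by simp
    next
      case False
      then have "Z -` {S} = {}"
        unfolding Z_def by auto
      then show ?thesis
        by simp
    qed
    moreover have "Y -` {k} = (\<Union>S\<in>{S. g S = k}. Z -` {S})"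
      by (auto simp: Y_def)
    ultimately show ?thesis
      by auto
  qed
  moreover have "measure \<mu> {x. X x \<noteq> Y x} < e"
  proof -
    let ?D = "\<lambda>k. (X -` {k} - U k) \<union> (U k - X -` {k})"
    have D: "?D k \<in> sets \<mu>" for k
      using U sets_vimage[OF X] sets_\<mu> by auto
    have "{x. X x \<noteq> Y x} \<subseteq> (\<Union>k\<in>?K. ?D k)"
    proof
      fix x assume x: "x \<in> {x. X x \<noteq> Y x}"
      show "x \<in> (\<Union>k\<in>?K. ?D k)"
      proof (rule ccontr)
        assume "x \<notin> (\<Union>k\<in>?K. ?D k)"
        then have "\<And>k. k \<in> ?K \<Longrightarrow> x \<in> U k \<longleftrightarrow> X x = k"
          by blast
        then have "Z x = {X x}"
          by (auto simp: Z_def)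
        then show False
          using x by (simp add: Y_def g_single)
      qed
    qed
    then have "measure \<mu> {x. X x \<noteq> Y x} \<le> measure \<mu> (\<Union>k\<in>?K. ?D k)"
      using D fin by (intro finite_measure_mono sets.finite_UN) auto
    also have "\<dots> \<le> (\<Sum>k\<in>?K. measure \<mu> (?D k))"
      using D fin by (intro finite_measure_subadditive_finite) auto
    also have "\<dots> < (\<Sum>k\<in>?K. e / real (card ?K))"
      using fin U(3) by (intro sum_strict_mono) auto
    also have "\<dots> = e"
      using pos by simp
    finally show ?thesis .
  qed
  ultimately show ?thesis
    by blast
qed

text \<open>Continuity at 0 matters because cell probabilities may tend to 0; there
  \<open>t * ln t\<close> tends to 0, which is also its value.\<close>

lemma continuous_mult_ln: "continuous_on {0..} (\<lambda>t::real. t * ln t)"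
proof (rule continuous_on_eq_continuous_within[THEN iffD2], intro ballI)
  fix t :: real assume "t \<in> {0..}"
  show "continuous (at t within {0..}) (\<lambda>t. t * ln t)"
  proof (cases "t = 0")
    case True
    have "((\<lambda>t::real. t * ln t) \<longlongrightarrow> 0) (at_right 0)"
      by real_asymp
    moreover have "at (0::real) within {0..} = at_right 0"
      by (rule at_within_Ici_at_right)
    ultimately show ?thesis
      unfolding True by (simp add: continuous_within)
  next
    case False
    then have "isCont (\<lambda>t. t * ln t) t"
      by (intro continuous_intros) auto
    then show ?thesis
      using continuous_at_imp_continuous_at_within by blast
  qed
qed

section \<open>Continuity of entropy under small changes of the labelling\<close>

context full_prob_space
begin

lemma abs_prob_diff_le:
  assumes "B \<in> sets M" "C \<in> sets M" "D \<in> sets M" "B - C \<subseteq> D" "C - B \<subseteq> D"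
  shows "\<bar>prob B - prob C\<bar> \<le> prob D"
proof -
  have "prob B \<le> prob (C \<union> D)" "prob C \<le> prob (B \<union> D)"
    using assms by (auto intro!: finite_measure_mono)
  moreover have "prob (C \<union> D) \<le> prob C + prob D" "prob (B \<union> D) \<le> prob B + prob D"
    using assms by (auto intro!: measure_Un_le)
  ultimately show ?thesis
    by linarith
qed

text \<open>Over the common finite \<open>K\<close> the entropy is a finite sum of continuous
  functions of cell probabilities, and each of these moves by at most the probability of
  disagreement.\<close>

lemma label_entropy_tendsto:
  assumes X: "simple_function M X" and Y: "\<And>n. simple_function M (Y n)"
    and K: "finite K" "range X \<subseteq> K" "\<And>n. range (Y n) \<subseteq> K"
    and lim: "(\<lambda>n. prob {x. X x \<noteq> Y n x}) \<longlonglongrightarrow> 0"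
  shows "(\<lambda>n. H (Y n)) \<longlonglongrightarrow> H X"
proof -
  have "(\<lambda>n. prob (Y n -` {k})) \<longlonglongrightarrow> prob (X -` {k})" for k
  proof -
    have ne: "{x. X x \<noteq> Y n x} \<in> sets M" for n
    proof -
      have eq: "{x. X x \<noteq> Y n x} = (\<lambda>x. (X x, Y n x)) -` {(a, b). a \<noteq> b}"
        by auto
      show ?thesis
        unfolding eq by (intro sets_vimage simple_function_Pair X Y)
    qed
    have "\<bar>prob (Y n -` {k}) - prob (X -` {k})\<bar> \<le> prob {x. X x \<noteq> Y n x}" for n
      by (rule abs_prob_diff_le) (use X Y ne in \<open>auto simp: sets_vimage\<close>)
    then have "(\<lambda>n. prob (Y n -` {k}) - prob (X -` {k})) \<longlonglongrightarrow> 0"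
      by (intro Lim_null_comparison[OF _ lim]) auto
    then show ?thesis
      by (simp add: LIM_zero_iff)
  qed
  then have "(\<lambda>n. prob (Y n -` {k}) * ln (prob (Y n -` {k}))) \<longlonglongrightarrow> prob (X -` {k}) * ln (prob (X -` {k}))" for k
    by (intro continuous_on_tendsto_compose[OF continuous_mult_ln]) auto
  then show ?thesis
    unfolding label_entropy_superset[OF K(1,2)] label_entropy_superset[OF K(1) K(3)]
    by (intro tendsto_minus tendsto_sum)
qed

end

text \<open>Let clopen labellings \<open>Y n\<close> disagree with \<open>X\<close> with probability
  below \<open>1 / (n + 1)\<close>. Then \<open>H (X, Y n)\<close> tends to
  \<open>H (X, X) = H X\<close> and \<open>H (Y n)\<close> to \<open>H X\<close>, so their
  difference tends to 0.\<close>

lemma clopen_label_small_conditional_entropy: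
  fixes \<mu> :: "'a::discrete_topology config measure" and X :: "'a config \<Rightarrow> 'k"
  assumes "prob_space \<mu>" and sets_\<mu>: "sets \<mu> = sets borel" and X: "simple_function \<mu> X" and "0 < e"
  shows "\<exists>Y :: 'a config \<Rightarrow> 'k. finite (range Y) \<and> (\<forall>k. open (Y -` {k})) \<and>
    label_entropy \<mu> (\<lambda>x. (X x, Y x)) - label_entropy \<mu> Y < e"
proof -
  interpret full_prob_space \<mu>
    using assms(1) sets_eq_imp_space_eq[OF sets_\<mu>] by (simp add: full_prob_space_def full_prob_space_axioms_def)
  have fin: "finite (range X)"
    by (rule simple_function_finite_range[OF X])
  have "\<forall>n. \<exists>Y. range Y \<subseteq> range X \<and> (\<forall>k. open (Y -` {k})) \<and> prob {x. X x \<noteq> Y x} < inverse (real (Suc n))"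
    by (intro allI clopen_label_approximation assms(1,2) X) simp
  then obtain Y where Y: "\<And>n. range (Y n) \<subseteq> range X" "\<And>n k. open (Y n -` {k})"
      and small: "\<And>n. prob {x. X x \<noteq> Y n x} < inverse (real (Suc n))"
    by (elim choice[THEN exE]) blast
  have lim: "(\<lambda>n. prob {x. X x \<noteq> Y n x}) \<longlonglongrightarrow> 0"
    using small by (intro Lim_null_comparison[OF _ LIMSEQ_inverse_real_of_nat]) (auto intro!: always_eventually less_imp_le)
  have sY: "simple_function \<mu> (Y n)" for n
    using Y fin sets_\<mu> by (auto simp: simple_function_def intro: finite_subset)
  have "(\<lambda>n. H (Y n)) \<longlonglongrightarrow> H X"
    by (rule label_entropy_tendsto[OF X sY fin _ Y(1) lim]) auto
  moreover have "(\<lambda>n. H (\<lambda>x. (X x, Y n x))) \<longlonglongrightarrow> H (\<lambda>x. (X x, X x))"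
    using lim Y(1) fin
    by (intro label_entropy_tendsto[where K = "range X \<times> range X"] simple_function_Pair X sY) auto
  moreover have "H (\<lambda>x. (X x, X x)) = H X"
    by (rule label_entropy_cong[symmetric]) (use fin in auto)
  ultimately have "(\<lambda>n. H (\<lambda>x. (X x, Y n x)) - H (Y n)) \<longlonglongrightarrow> 0"
    using tendsto_diff by fastforce
  then have "eventually (\<lambda>n. H (\<lambda>x. (X x, Y n x)) - H (Y n) < e) sequentially"
    using \<open>0 < e\<close> by (rule order_tendstoD)
  then obtain n where "H (\<lambda>x. (X x, Y n x)) - H (Y n) < e"
    by (auto simp: eventually_sequentially)
  moreover have "finite (range (Y n))"
    using Y(1) fin by (rule finite_subset)
  ultimately show ?thesis
    using Y(2) by blast
qed

subsection \<open>Entropy rates\<close>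

text \<open>Frame joins are formed from images, whereas labellings pull back along preimages; hence
  the sign in \<open>labels_frame_join\<close>.\<close>

lemma shift_image_eq_vimage: "shift v ` B = shift (- v) -` B"
proof -
  have "shift v (shift (- v) x) = x" "shift (- v) (shift v x) = x" for x :: "'a config"
    by (simp_all add: shift_def)
  then show ?thesis
    by (auto simp: image_iff) metis
qed

lemma continuous_on_shift: "continuous_on UNIV (shift v :: 'a::topological_space config \<Rightarrow> 'a config)"
  unfolding shift_def by (intro continuous_on_coordinatewise_then_product continuous_on_product_coordinates)

lemma labels_frame_join:
  assumes "labels X P"
  shows "labels (\<lambda>x. restrict (\<lambda>v. X (shift (- v) x)) (frame r n)) (frame_join r P n)"
  unfolding frame_join_def shift_image_eq_vimage by (intro labels_join labels_vimage assms)

lemma finite_frame: "finite (frame r n)"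
  by (simp add: frame_def finite_square)

text \<open>The difference of two odd squares contains the factor \<open>r\<close>, and the other
  factor \<open>8 n + 4 - 4 r\<close> is at most \<open>12 n\<close> as \<open>1 \<le> n\<close>.
  Growth linear in \<open>n\<close> is what the division by \<open>n\<close> can absorb.\<close>

lemma card_frame_le:
  assumes "r \<le> n" "1 \<le> n"
  shows "real (card (frame r n)) \<le> 12 * real r * real n"
proof -
  have card_square: "card (square m) = (2 * m + 1) ^ 2" for m
    by (simp add: square_def card_cartesian_product power2_eq_square nat_add_distrib nat_mult_distrib)
  have sub: "square (n - r) \<subseteq> square n"
    by (rule square_mono) simp
  have "real (card (frame r n)) = real (card (square n)) - real (card (square (n - r)))"
    unfolding frame_def using sub finite_square
    by (subst card_Diff_subset) (auto intro!: of_nat_diff card_mono)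
  also have "\<dots> = (2 * real n + 1)\<^sup>2 - (2 * (real n - real r) + 1)\<^sup>2"
    using assms by (simp add: card_square of_nat_diff add.commute)
  also have "\<dots> = real r * (8 * real n + 4 - 4 * real r)"
    by (simp add: power2_eq_square algebra_simps)
  also have "\<dots> \<le> real r * (12 * real n)"
    using assms by (intro mult_left_mono) auto
  finally show ?thesis
    by (simp add: mult_ac)
qed

lemma labels_zero_partition: "labels (\<lambda>x :: 'a config. x (0, 0)) zero_partition"
  unfolding zero_partition_def labels_def by auto

lemma finite_open_cover_labels:
  assumes "finite (range X)" "\<And>k. open (X -` {k})"
  shows "finite_open_cover ((\<lambda>k. X -` {k}) ` range X)"
  using assms by (auto simp: finite_open_cover_def)

lemma ER_cover_le_ER_top: "finite_open_cover C \<Longrightarrow> ER_cover r C F \<le> ER_top r F"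
  unfolding ER_top_def by (rule SUP_upper) simp

lemma measure_preserving_map_invariant:
  fixes F :: "'a::topological_space config \<Rightarrow> 'a config"
  assumes "cellular_automaton F" "\<mu> \<in> invariant_measures F"
  shows "measure_preserving_map \<mu> F"
proof -
  have \<mu>: "prob_space \<mu>" "sets \<mu> = sets borel" "distr \<mu> borel F = \<mu>"
    using assms(2) by (auto simp: invariant_measures_def)
  interpret prob_space \<mu>
    by fact
  have "F \<in> borel \<rightarrow>\<^sub>M borel"
    using assms(1) by (intro borel_measurable_continuous_onI) (simp add: cellular_automaton_def)
  moreover have "distr \<mu> \<mu> F = distr \<mu> borel F"
    by (rule distr_cong) (simp_all add: \<mu>(2))
  ultimately show ?thesis
    using \<mu> sets_eq_imp_space_eq[OF \<mu>(2)] by unfold_locales (simp_all cong: measurable_cong_sets)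
qed

text \<open>Frame joins of \<open>P\<close> are again finitely labelled, so the entropy comparison
  holds for every \<open>n\<close> and survives the \<open>limsup\<close>; as an open cover,
  \<open>P\<close> takes part in the supremum on the right.\<close>

lemma ER_partition_le_ER_top:
  fixes F :: "'a::topological_space config \<Rightarrow> 'a config"
  assumes F: "cellular_automaton F" and \<mu>: "\<mu> \<in> invariant_measures F"
    and X: "labels X P" "finite (range X)" "\<And>k. open (X -` {k})" and P: "finite_open_cover P"
  shows "ER_partition r \<mu> P F \<le> ER_top r F"
proof -
  interpret measure_preserving_map \<mu> F
    by (rule measure_preserving_map_invariant) fact+
  have sets_\<mu>: "sets \<mu> = sets borel"
    using \<mu> by (simp add: invariant_measures_def)
  have sX: "simple_function \<mu> X"
    using X sets_\<mu> by (auto simp: simple_function_def)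
  have shift: "shift v \<in> \<mu> \<rightarrow>\<^sub>M \<mu>" for v
    using borel_measurable_continuous_onI[OF continuous_on_shift] measurable_cong_sets[OF sets_\<mu> sets_\<mu>]
    by blast
  have "dyn_entropy \<mu> (frame_join r P n) F \<le> dyn_cover_entropy (frame_join r P n) F" for n
    by (intro dyn_entropy_le_dyn_cover_entropy[OF labels_frame_join[OF X(1)]] simple_function_restrict
        finite_frame simple_function_comp_measurable[OF sX shift])
  then have "ER_partition r \<mu> P F \<le> ER_cover r P F"
    unfolding ER_partition_def ER_cover_def
    by (intro Limsup_mono always_eventually allI) (simp add: divide_right_mono)
  also have "\<dots> \<le> ER_top r F"
    by (rule ER_cover_le_ER_top[OF P])
  finally show ?thesis .
qed

lemma ER_measure_le_ER_top:
  fixes F :: "'a::discrete_topology config \<Rightarrow> 'a config"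
  assumes F: "cellular_automaton F" and \<mu>: "\<mu> \<in> shift_invariant_measures F"
  shows "ER_measure r \<mu> F \<le> ER_top r F"
  unfolding ER_measure_def
proof (rule SUP_least, clarify)
  fix P :: "'a config set set" assume "finite_measurable_partition P"
  then have P: "finite P" "partition_on UNIV P" "P \<subseteq> sets borel"
    by (auto simp: finite_measurable_partition_def)
  have inv: "\<mu> \<in> invariant_measures F"
    using \<mu> by (simp add: shift_invariant_measures_def)
  interpret measure_preserving_map \<mu> F
    by (rule measure_preserving_map_invariant) fact+
  have sets_\<mu>: "sets \<mu> = sets borel"
    using inv by (simp add: invariant_measures_def)
  have shift: "shift v \<in> \<mu> \<rightarrow>\<^sub>M \<mu>" for v
    using borel_measurable_continuous_onI[OF continuous_on_shift] measurable_cong_sets[OF sets_\<mu> sets_\<mu>]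
    by blast
  have shift_inv: "distr \<mu> \<mu> (shift v) = \<mu>" for v
  proof -
    have "distr \<mu> \<mu> (shift v) = distr \<mu> borel (shift v)"
      by (rule distr_cong) (simp_all add: sets_\<mu>)
    then show ?thesis
      using \<mu> by (simp add: shift_invariant_measures_def del: split_paired_All)
  qed
  obtain X :: "'a config \<Rightarrow> 'a config set" where X: "labels X P"
    using labels_partition_on[OF P(2)] by blast
  have sX: "simple_function \<mu> X"
  proof -
    have "(\<lambda>k. X -` {k}) ` range X \<subseteq> P"
      using X by (auto simp: labels_def)
    moreover have "inj_on (\<lambda>k. X -` {k}) (range X)"
      by (auto simp: inj_on_def)
    ultimately have "finite (range X)"
      using P(1) by (meson finite_imageD finite_subset)
    moreover have "X -` {X x} \<in> sets \<mu>" for x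
      using X P(3) sets_\<mu> by (auto simp: labels_def)
    ultimately show ?thesis
      by (auto simp: simple_function_def)
  qed
  show "ER_partition r \<mu> P F \<le> ER_top r F"
  proof (rule ereal_le_epsilon2)
    fix d :: real assume "0 < d"
    \<comment> \<open>Chosen so that the final error \<open>12 r e\<close> is at most
      \<open>d\<close>; the added 1 keeps the denominator positive when
      \<open>r = 0\<close>.\<close>
    define e where "e = d / (12 * real r + 1)"
    have "0 < e" "12 * real r * e \<le> d"
      using \<open>0 < d\<close> by (auto simp: e_def field_simps add_pos_nonneg)
    obtain Y :: "'a config \<Rightarrow> 'a config set" where Y: "finite (range Y)" "\<And>k. open (Y -` {k})"
        and small: "H (\<lambda>x. (X x, Y x)) - H Y < e"
      using clopen_label_small_conditional_entropy[OF prob_space_axioms sets_\<mu> sX \<open>0 < e\<close>] by blast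
    define Q where "Q = (\<lambda>k. Y -` {k}) ` range Y"
    have Q: "labels Y Q"
      unfolding Q_def by (rule labels_level_sets)
    have sY: "simple_function \<mu> Y"
      using Y sets_\<mu> by (auto simp: simple_function_def)
    \<comment> \<open>Here \<open>H_orbit_family_le\<close> is used with
      \<open>S v = shift (- v)\<close> over the frame; this is where shift invariance
      enters.\<close>
    have le: "dyn_entropy \<mu> (frame_join r P n) F \<le> dyn_entropy \<mu> (frame_join r Q n) F
        + real (card (frame r n)) * (H (\<lambda>x. (X x, Y x)) - H Y)" for n
      by (intro dyn_entropy_le_of_orbits[OF labels_frame_join[OF X] _ labels_frame_join[OF Q]]
          simple_function_restrict finite_frame simple_function_comp_measurable[OF sX shift]
          simple_function_comp_measurable[OF sY shift] H_orbit_family_le sX sY shift shift_inv)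
    have "dyn_entropy \<mu> (frame_join r P n) F / real n
        \<le> dyn_entropy \<mu> (frame_join r Q n) F / real n + d" if n: "max 1 r \<le> n" for n
    proof -
      have "real (card (frame r n)) * (H (\<lambda>x. (X x, Y x)) - H Y) \<le> real (card (frame r n)) * e"
        using small by (intro mult_left_mono) auto
      also have "\<dots> \<le> 12 * real r * real n * e"
        using card_frame_le[of r n] n \<open>0 < e\<close> by (intro mult_right_mono) auto
      also have "\<dots> \<le> real n * d"
        using mult_left_mono[OF \<open>12 * real r * e \<le> d\<close>, of "real n"] by (simp add: mult_ac)
      finally show ?thesis
        using le[of n] n by (simp add: field_simps)
    qed
    then have "ER_partition r \<mu> P F \<le>
        limsup (\<lambda>n. ereal (dyn_entropy \<mu> (frame_join r Q n) F / real n) + ereal d)"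
      unfolding ER_partition_def
      by (intro Limsup_mono eventually_sequentiallyI[of "max 1 r"]) simp
    also have "\<dots> = ER_partition r \<mu> Q F + ereal d"
      unfolding ER_partition_def by (intro Limsup_add_ereal_right) auto
    also have "\<dots> \<le> ER_top r F + ereal d"
      using ER_partition_le_ER_top[OF F inv Q Y finite_open_cover_labels[OF Y, folded Q_def]]
      by (intro add_right_mono)
    finally show "ER_partition r \<mu> P F \<le> ER_top r F + ereal d" .
  qed
qed

theorem proposition17:
  fixes F :: "'a::{finite, discrete_topology} config \<Rightarrow> 'a config" and r :: nat
  assumes "cellular_automaton F" and "is_radius r F"
  shows "ER_top r F \<ge> (SUP \<mu> \<in> shift_invariant_measures F. ER_measure r \<mu> F) \<and>
         ER_top r F \<ge> (SUP \<mu> \<in> invariant_measures F. ER_partition r \<mu> zero_partition F)"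
proof (intro conjI SUP_least)
  fix \<mu> assume "\<mu> \<in> shift_invariant_measures F"
  then show "ER_measure r \<mu> F \<le> ER_top r F"
    by (rule ER_measure_le_ER_top[OF assms(1)])
next
  fix \<mu> assume \<mu>: "\<mu> \<in> invariant_measures F"
  let ?X = "\<lambda>x :: 'a config. x (0, 0)"
  have X: "open (?X -` {a})" for a
    by (rule clopen_if_finite_coordinates(1)[of "{(0, 0)}"]) auto
  \<comment> \<open>Constant configurations realise every letter, so \<open>zero_partition\<close>
    is exactly the family of level sets.\<close>
  have "range ?X = UNIV"
    by (rule surjI[of _ "\<lambda>a u. a"]) simp
  then have "zero_partition = (\<lambda>a. ?X -` {a}) ` range ?X"
    by (auto simp: zero_partition_def vimage_def)
  then have "finite_open_cover (zero_partition :: 'a config set set)"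
    using finite_open_cover_labels[of ?X] X by simp
  then show "ER_partition r \<mu> zero_partition F \<le> ER_top r F"
    by (intro ER_partition_le_ER_top[OF assms(1) \<mu> labels_zero_partition]) (use X in auto)
qed

end
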